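(* Let $t$ be a positive integer and $n$ an integer with $2<n<\frac{15+\sqrt{33}}{24}t^2$. Let $M$ be an $n\times(n-1)$ $t$-disjunct matrix. Then the rows of $M$ can be permuted so that the first $n-1$ rows form a permutation matrix of degree $n-1$ (the last row being arbitrary).
   Context: A binary $n\times w$ matrix is $t$-disjunct if its columns are distinct and for every $j\le t$ the Boolean sum of any $j$ columns does not contain any other column (equivalently, it is the incidence matrix of a $t$-cover-free family). A permutation matrix of degree $k$ is a $k\times k$ $0/1$ matrix with exactly one $1$ in each row and column. *)

theory Defs
  imports Complex_Main "HOL-Combinatorics.Permutations" "Jordan_Normal_Form.Matrix"
begin

definition binary_mat :: "nat mat \<Rightarrow> bool" where
  "binary_mat M \<longleftrightarrow> elements_mat M \<subseteq> {0, 1}"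

definition bool_sum_cols :: "nat mat \<Rightarrow> nat set \<Rightarrow> nat vec" where
  "bool_sum_cols M J = vec (dim_row M) (\<lambda>i. if \<exists>j\<in>J. M $$ (i, j) = 1 then 1 else 0)"

text \<open>For binary vectors, containment of supports is the componentwise order on vectors.
  The columns to be summed are given by their set of indices, so they are \<open>j\<close> distinct columns,
  and an ``other'' column is one whose index lies outside that set.\<close>

definition disjunct_mat :: "nat \<Rightarrow> nat mat \<Rightarrow> bool" where
  "disjunct_mat t M \<longleftrightarrow>
     binary_mat M \<and>
     inj_on (col M) {..<dim_col M} \<and>
     (\<forall>j\<le>t. \<forall>J. J \<subseteq> {..<dim_col M} \<and> card J = j \<longrightarrow>
        (\<forall>c\<in>{..<dim_col M} - J. \<not> col M c \<le> bool_sum_cols M J))"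

definition permutation_mat :: "nat \<Rightarrow> nat mat \<Rightarrow> bool" where
  "permutation_mat k P \<longleftrightarrow>
     P \<in> carrier_mat k k \<and> binary_mat P \<and>
     (\<forall>i<k. \<exists>!j. j < k \<and> P $$ (i, j) = 1) \<and>
     (\<forall>j<k. \<exists>!i. i < k \<and> P $$ (i, j) = 1)"

definition permute_rows :: "(nat \<Rightarrow> nat) \<Rightarrow> 'a mat \<Rightarrow> 'a mat" where
  "permute_rows \<sigma> M = mat (dim_row M) (dim_col M) (\<lambda>(i, j). M $$ (\<sigma> i, j))"

definition first_rows :: "nat \<Rightarrow> 'a mat \<Rightarrow> 'a mat" where
  "first_rows k M = mat k (dim_col M) (\<lambda>(i, j). M $$ (i, j))"

end

theory Submission
  imports Defs
begin

text \<open>View the columns as sets of rows and let \<open>c = (15 + sqrt 33) / 24\<close>. If every column has a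
  private row, i.e. one contained in no other column, these rows form the permutation matrix.
  Suppose that some columns have none. Covering such a column \<open>F\<close> by others, two rows at a time
  where possible, shows that the graph of pairs of rows of \<open>F\<close> shared with another column has
  matching number at most \<open>|F| - t - 1\<close>. The Erdos-Gallai theorem then leaves at least
  \<open>c t^2\<close> ordered pairs that belong to \<open>F\<close> alone, provided \<open>|F| < c (2 t - 1)\<close>. As such pairs
  of different columns are distinct and avoid one private row of each remaining column,
  double counting gives \<open>n \<ge> c t^2\<close>. A column with \<open>|F| \<ge> c (2 t - 1)\<close> is removed
  together with its rows, which leaves a \<open>(t - 1)\<close>-disjunct matrix with fewer than
  \<open>c (t - 1)^2\<close> rows and more columns than rows, so induction on \<open>t\<close> applies.\<close>

section \<open>Matchings\<close>

text \<open>A matching is encoded as a symmetric relation: each edge is two ordered pairs,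
  \<open>Domain M\<close> is the set of covered vertices, and \<open>card M\<close> is twice the
  number of edges.\<close>

definition matching :: "('a \<times> 'a) set \<Rightarrow> bool" where
  "matching M \<longleftrightarrow> sym M \<and> irrefl M \<and> single_valued M"

lemma matching_symD: "matching M \<Longrightarrow> (x, y) \<in> M \<Longrightarrow> (y, x) \<in> M"
  by (auto simp: matching_def dest: symD)

lemma matching_uniqueD: "matching M \<Longrightarrow> (x, y) \<in> M \<Longrightarrow> (x, z) \<in> M \<Longrightarrow> y = z"
  by (auto simp: matching_def dest: single_valuedD)

lemma matching_neqD: "matching M \<Longrightarrow> (x, y) \<in> M \<Longrightarrow> x \<noteq> y"
  by (auto simp: matching_def irrefl_def)

lemma matching_empty: "matching {}"
  by (simp add: matching_def sym_def irrefl_def)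

lemma matching_insert:
  assumes "matching M" "x \<noteq> y" "x \<notin> Domain M" "y \<notin> Domain M"
  shows "matching (insert (x, y) (insert (y, x) M))"
  using assms unfolding matching_def sym_def irrefl_def single_valued_def Domain_iff by blast

lemma matching_remove:
  assumes "matching M" "(x, y) \<in> M"
  shows "matching (M - {(x, y), (y, x)})"
  using assms unfolding matching_def sym_def irrefl_def single_valued_def by blast

lemma Domain_matching_remove:
  assumes "matching M" "(x, y) \<in> M"
  shows "Domain (M - {(x, y), (y, x)}) = Domain M - {x, y}"
  using assms matching_symD[OF assms] unfolding matching_def single_valued_def by blast

text \<open>Induction edge by edge: adding single pairs would leave the symmetric relations.\<close>

lemma matching_induct [consumes 2, case_names empty insert]:
  assumes "finite M" "matching M"
    and empty: "P {}"
    and insert: "\<And>x y M. \<lbrakk>finite M; matching M; x \<noteq> y; x \<notin> Domain M; y \<notin> Domain M; P M\<rbrakk>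
      \<Longrightarrow> P (insert (x, y) (insert (y, x) M))"
  shows "P M"
  using assms(1,2)
proof (induction "card M" arbitrary: M rule: less_induct)
  case less
  show ?case
  proof (cases "M = {}")
    case False
    then obtain x y where xy: "(x, y) \<in> M" by auto
    let ?M = "M - {(x, y), (y, x)}"
    have M: "M = insert (x, y) (insert (y, x) ?M)"
      using xy matching_symD[OF less.prems(2) xy] by blast
    have "card ?M < card M"
      using xy less.prems(1) by (intro psubset_card_mono) auto
    then have "P ?M"
      using less.hyps less.prems matching_remove[OF less.prems(2) xy] by simp
    then have "P (insert (x, y) (insert (y, x) ?M))"
      using less.prems xy matching_neqD[OF less.prems(2) xy]
      by (intro insert matching_remove) (auto simp: Domain_matching_remove[OF less.prems(2) xy])
    then show ?thesis
      using M by simp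
  qed (simp add: empty)
qed

lemma card_matching_insert:
  assumes "finite M" "x \<noteq> y" "x \<notin> Domain M" "y \<notin> Domain M"
  shows "card (insert (x, y) (insert (y, x) M)) = card M + 2"
proof -
  have "(x, y) \<notin> M" "(y, x) \<notin> M" using assms by auto
  then show ?thesis using assms by simp
qed

lemma card_matching:
  assumes "finite M" "matching M"
  shows "card (Domain M) = card M" and "even (card M)"
proof -
  have "card (Domain M) = card M \<and> even (card M)"
    using assms
  proof (induction rule: matching_induct)
    case (insert x y M)
    then show ?case
      by (simp add: card_matching_insert[OF insert(1,3-5)] finite_Domain)
  qed simp
  then show "card (Domain M) = card M" and "even (card M)" by auto
qed

section \<open>Exchange along alternating paths\<close>

text \<open>One step along an alternating path: the edge ab turns into bc, so a becomes free, c
  becomes covered and the size stays the same.\<close>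

lemma matching_swap:
  assumes M: "finite M" "matching M" and ab: "(a, b) \<in> M" and c: "c \<notin> Domain M"
  defines "M' \<equiv> insert (b, c) (insert (c, b) (M - {(a, b), (b, a)}))"
  shows "matching M'" "card M' = card M" "Domain M' = insert c (Domain M - {a})"
proof -
  let ?M = "M - {(a, b), (b, a)}"
  have ba: "(b, a) \<in> M" and neq: "a \<noteq> b"
    using matching_symD[OF M(2) ab] matching_neqD[OF M(2) ab] by auto
  have D: "Domain ?M = Domain M - {a, b}"
    by (rule Domain_matching_remove[OF M(2) ab])
  have bc: "b \<noteq> c" using ba c by auto
  show "matching M'"
    unfolding M'_def using bc c by (intro matching_insert matching_remove M ab) (auto simp: D)
  have "card M' = card ?M + 2"
    unfolding M'_def using bc c M(1) by (intro card_matching_insert) (auto simp: D)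
  moreover have "card M = card ?M + 2"
  proof -
    have "M = insert (a, b) (insert (b, a) ?M)" using ab ba by blast
    moreover have "card (insert (a, b) (insert (b, a) ?M)) = card ?M + 2"
      using neq M(1) by (intro card_matching_insert) (auto simp: D)
    ultimately show ?thesis by simp
  qed
  ultimately show "card M' = card M" by simp
  show "Domain M' = insert c (Domain M - {a})"
    unfolding M'_def Domain_insert D using ba neq by auto
qed

text \<open>This amounts to switching \<open>M1\<close> along the component of \<open>w\<close> in the symmetric difference
  of \<open>M1\<close> and \<open>M2\<close>, a path with at most one of its ends in \<open>{u, v}\<close>. Keeping track of
  \<open>M1 \<inter> M2\<close> lets the induction proceed edge by edge, without talking about paths.\<close>

lemma maximum_matching_exchange:
  assumes R: "finite R" "sym R"
    and max: "\<And>M. M \<subseteq> R \<Longrightarrow> matching M \<Longrightarrow> card M \<le> N"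
    and M1: "M1 \<subseteq> R" "matching M1" "card M1 = N"
    and M2: "M2 \<subseteq> R" "matching M2" "card M2 = N" "w \<notin> Domain M2"
    and uv: "u \<notin> Domain M1" "v \<notin> Domain M1" "u \<noteq> v"
  shows "\<exists>M\<subseteq>R. matching M \<and> card M = N \<and> M1 \<inter> M2 \<subseteq> M \<and> w \<notin> Domain M
    \<and> (u \<notin> Domain M \<or> v \<notin> Domain M)"
  using M2
proof (induction "card (M1 - M2)" arbitrary: M2 w rule: less_induct)
  case less
  note M2 = less.prems
  have fin: "finite M1" "finite M2"
    using R(1) M1(1) M2(1) finite_subset by auto
  show ?case
  proof (cases "w \<in> Domain M1")
    case False
    then show ?thesis using M1 uv by blast
  next
    case True
    then obtain w1 where w1: "(w, w1) \<in> M1" by auto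
    have w1': "(w1, w) \<in> M1" "w \<noteq> w1"
      using matching_symD[OF M1(2) w1] matching_neqD[OF M1(2) w1] by auto
    \<comment> \<open>If \<open>w1\<close> were free in \<open>M2\<close>, the edge from
      \<open>w\<close> to \<open>w1\<close> would enlarge the maximum matching
      \<open>M2\<close>.\<close>
    have "w1 \<in> Domain M2"
    proof (rule ccontr)
      assume "w1 \<notin> Domain M2"
      then have "matching (insert (w, w1) (insert (w1, w) M2))"
        and "card (insert (w, w1) (insert (w1, w) M2)) = N + 2"
        using matching_insert[of M2 w w1] card_matching_insert[of M2 w w1] fin M2 w1' by auto
      moreover have "insert (w, w1) (insert (w1, w) M2) \<subseteq> R"
        using M1 M2 w1 w1' by auto
      ultimately show False
        using max[of "insert (w, w1) (insert (w1, w) M2)"] by simp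
    qed
    then obtain w2 where w2: "(w1, w2) \<in> M2" by auto
    have w2': "(w2, w1) \<in> M2" "w2 \<noteq> w" "w2 \<noteq> w1"
      using matching_symD[OF M2(2) w2] matching_neqD[OF M2(2) w2] M2(4) by auto
    have w2n: "(w1, w2) \<notin> M1" "(w2, w1) \<notin> M1"
      using matching_uniqueD[OF M1(2) w1'(1)] matching_symD[OF M1(2)] w2'(2) by blast+
    have wn: "(w, w1) \<notin> M2" "(w1, w) \<notin> M2"
      using M2(4) matching_symD[OF M2(2)] by blast+
    show ?thesis
    proof (cases "w2 \<in> Domain M1")
      \<comment> \<open>The path ends at \<open>w2\<close>: one swap in \<open>M1\<close> frees
        \<open>w\<close>. The only newly covered vertex \<open>w2\<close> cannot be both
        \<open>u\<close> and \<open>v\<close>.\<close>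
      case False
      let ?M = "insert (w1, w2) (insert (w2, w1) (M1 - {(w, w1), (w1, w)}))"
      note sw = matching_swap[OF fin(1) M1(2) w1 False]
      have "?M \<subseteq> R" using M1 M2 w2 w2' by auto
      moreover have "M1 \<inter> M2 \<subseteq> ?M" using wn by auto
      moreover have "w \<notin> Domain ?M" "u \<notin> Domain ?M \<or> v \<notin> Domain ?M"
        unfolding sw(3) using uv w2' by auto
      ultimately show ?thesis
        using sw(1,2) M1(3) by (intro exI[of _ ?M]) simp
    next
      \<comment> \<open>Moving the edge of \<open>M2\<close> back to \<open>w w1\<close> frees
        \<open>w2\<close> and enlarges the overlap with \<open>M1\<close>. The induction hypothesis
        keeps this edge in \<open>M3\<close>, where a swap to \<open>w1 w2\<close> frees
        \<open>w\<close> again. It covers only \<open>w2\<close>, which is neither \<open>u\<close>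
        nor \<open>v\<close> as it lies in \<open>Domain M1\<close>.\<close>
      case True
      let ?M2 = "insert (w1, w) (insert (w, w1) (M2 - {(w2, w1), (w1, w2)}))"
      note sw2 = matching_swap[OF fin(2) M2(2) w2'(1) M2(4)]
      have "card (M1 - ?M2) < card (M1 - M2)"
        using fin w1 wn w2n by (intro psubset_card_mono) auto
      moreover have "?M2 \<subseteq> R" using M1 M2 w1 w1' by auto
      moreover have "w2 \<notin> Domain ?M2"
        unfolding sw2(3) using w2'(2) by auto
      ultimately obtain M3 where M3: "M3 \<subseteq> R" "matching M3" "card M3 = N" "M1 \<inter> ?M2 \<subseteq> M3"
        "w2 \<notin> Domain M3" "u \<notin> Domain M3 \<or> v \<notin> Domain M3"
        using less.hyps[of ?M2 w2] sw2(1,2) M2(3) by auto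
      have "finite M3" using M3(1) R(1) finite_subset by auto
      moreover have w3: "(w, w1) \<in> M3" using M3(4) w1 by auto
      ultimately have sw: "matching (insert (w1, w2) (insert (w2, w1) (M3 - {(w, w1), (w1, w)})))"
        "card (insert (w1, w2) (insert (w2, w1) (M3 - {(w, w1), (w1, w)}))) = N"
        "Domain (insert (w1, w2) (insert (w2, w1) (M3 - {(w, w1), (w1, w)})))
          = insert w2 (Domain M3 - {w})"
        using matching_swap[of M3 w w1 w2] M3 by auto
      let ?M = "insert (w1, w2) (insert (w2, w1) (M3 - {(w, w1), (w1, w)}))"
      have "?M \<subseteq> R" using M3 M2 w2 w2' by auto
      moreover have "M1 \<inter> M2 \<subseteq> ?M" using wn w2n M3(4) by auto
      moreover have "w \<notin> Domain ?M" "u \<notin> Domain ?M \<or> v \<notin> Domain ?M"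
        unfolding sw(3) using uv w2' M3(6) True by auto
      ultimately show ?thesis
        using sw(1,2) by (intro exI[of _ ?M]) simp
    qed
  qed
qed

section \<open>Edge bounds for graphs of bounded matching number\<close>

lemma maximum_matching_covers_edge:
  assumes R: "finite R" "sym R"
    and max: "\<And>M. M \<subseteq> R \<Longrightarrow> matching M \<Longrightarrow> card M \<le> N"
    and M: "M \<subseteq> R" "matching M" "card M = N"
    and xy: "(x, y) \<in> R" "x \<noteq> y"
  shows "x \<in> Domain M \<or> y \<in> Domain M"
proof (rule ccontr)
  assume "\<not> (x \<in> Domain M \<or> y \<in> Domain M)"
  moreover have "finite M" using M(1) R(1) finite_subset by auto
  ultimately have "matching (insert (x, y) (insert (y, x) M))"
    and "card (insert (x, y) (insert (y, x) M)) = N + 2"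
    using matching_insert[of M x y] card_matching_insert[of M x y] M xy by auto
  moreover have "insert (x, y) (insert (y, x) M) \<subseteq> R"
    using M xy symD[OF R(2)] by auto
  ultimately show False
    using max[of "insert (x, y) (insert (y, x) M)"] by simp
qed

text \<open>Edges are counted as ordered pairs, hence twice.\<close>

lemma card_graph_all_vertices_avoidable:
  assumes R: "finite R" "sym R" "irrefl R"
    and max: "\<And>M. M \<subseteq> R \<Longrightarrow> matching M \<Longrightarrow> card M \<le> N"
    and avoid: "\<And>x. x \<in> Domain R \<Longrightarrow> \<exists>M\<subseteq>R. matching M \<and> card M = N \<and> x \<notin> Domain M"
  shows "card R \<le> N * (N + 1)"
proof (cases "R = {}")
  case False
  note cover = maximum_matching_covers_edge[OF R(1,2) max]
  have irr: "x \<noteq> y" if "(x, y) \<in> R" for x y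
    using R(3) that by (auto simp: irrefl_def)
  obtain M where M: "M \<subseteq> R" "matching M" "card M = N"
  proof -
    obtain x where "x \<in> Domain R" using False by auto
    then show ?thesis using avoid that by metis
  qed
  have finM: "finite M" using M(1) R(1) finite_subset by auto
  have D: "finite (Domain M)" "card (Domain M) = N"
    using card_matching[OF finM M(2)] M(3) finM by (auto simp: finite_Domain)
  \<comment> \<open>A maximum matching that misses \<open>x\<close> must cover all neighbours of
    \<open>x\<close>.\<close>
  have deg: "card (R `` {x}) \<le> N" if "x \<in> Domain R" for x
  proof -
    obtain M' where M': "M' \<subseteq> R" "matching M'" "card M' = N" "x \<notin> Domain M'"
      using avoid \<open>x \<in> Domain R\<close> by blast
    have finM': "finite M'" using M'(1) R(1) finite_subset by auto
    have "R `` {x} \<subseteq> Domain M'"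
      using cover[OF _ _ M'(1-3)] irr M'(4) by blast
    then have "card (R `` {x}) \<le> card (Domain M')"
      by (intro card_mono) (auto simp: finite_Domain finM')
    then show ?thesis using card_matching[OF finM' M'(2)] M'(3) by simp
  qed
  \<comment> \<open>Otherwise the exchange gives a maximum matching that misses \<open>x\<close> and
    one of its neighbours \<open>u\<close>, \<open>v\<close>, hence leaves an edge
    uncovered.\<close>
  have one: "u = v" if uvx: "(u, x) \<in> R" "(v, x) \<in> R" "u \<notin> Domain M" "v \<notin> Domain M" for u v x
  proof (rule ccontr)
    assume "u \<noteq> v"
    obtain M' where "M' \<subseteq> R" "matching M'" "card M' = N" "x \<notin> Domain M'"
      using avoid[of x] symD[OF R(2) uvx(1)] by blast
    then obtain M'' where M'': "M'' \<subseteq> R" "matching M''" "card M'' = N" "x \<notin> Domain M''"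
      "u \<notin> Domain M'' \<or> v \<notin> Domain M''"
      using maximum_matching_exchange[OF R(1,2) max M, of M' x u v] uvx(3,4) \<open>u \<noteq> v\<close> by blast
    then show False
      using cover[OF _ _ M''(1-3) uvx(1)] cover[OF _ _ M''(1-3) uvx(2)] irr uvx(1,2) by blast
  qed
  \<comment> \<open>Pairs starting in \<open>Domain M\<close> number at most N * N by
    \<open>deg\<close>. The others end in \<open>Domain M\<close>, at distinct vertices by
    \<open>one\<close>, which gives N more.\<close>
  let ?A = "SIGMA x:Domain M. R `` {x}" and ?B = "{(u, x) \<in> R. u \<notin> Domain M}"
  have AB: "?A \<union> ?B = R" by auto
  have "card R \<le> card ?A + card ?B"
    using card_Un_le[of ?A ?B] unfolding AB .
  moreover have "card ?A \<le> N * N"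
  proof -
    have "card ?A = (\<Sum>x\<in>Domain M. card (R `` {x}))"
      using D R(1) by (intro card_SigmaI) (auto intro: finite_Image)
    also have "\<dots> \<le> (\<Sum>x\<in>Domain M. N)"
      using M(1) by (intro sum_mono deg) auto
    finally show ?thesis using D by simp
  qed
  moreover have "card ?B \<le> N"
  proof -
    have "inj_on snd ?B" using one by (auto simp: inj_on_def)
    moreover have "snd ` ?B \<subseteq> Domain M"
    proof
      fix x assume "x \<in> snd ` ?B"
      then obtain u where "(u, x) \<in> R" "u \<notin> Domain M" by auto
      then show "x \<in> Domain M" using cover[OF _ _ M, of u x] irr by blast
    qed
    ultimately show ?thesis
      using card_inj_on_le[of snd ?B "Domain M"] D by simp
  qed
  ultimately show ?thesis by simp
qed simp

text \<open>The two terms are the extremal graphs: a clique on 2k + 1 vertices, and k vertices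
  joined to everything. Either every non-isolated vertex is missed by some maximum matching, which
  gives the clique bound, or some vertex meets all matchings of full size, and deleting it lowers
  \<open>k\<close>. Integers keep the subtractions exact.\<close>

lemma erdos_gallai_matching:
  assumes "finite V" "R \<subseteq> V \<times> V" "sym R" "irrefl R"
    and "\<And>M. M \<subseteq> R \<Longrightarrow> matching M \<Longrightarrow> card M \<le> 2 * k"
  shows "int (card R) \<le> max (2 * int k * (2 * int k + 1))
    (int k * (int k - 1) + 2 * int k * (int (card V) - int k))"
  using assms
proof (induction k arbitrary: V R)
  case 0
  have finR: "finite R" using 0(1,2) finite_subset by blast
  have "R = {}"
  proof (rule ccontr)
    assume "R \<noteq> {}"
    then obtain x y where "(x, y) \<in> R" by auto
    moreover have "x \<noteq> y" using calculation 0(4) by (auto simp: irrefl_def)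
    ultimately show False
      using maximum_matching_covers_edge[OF finR 0(3), of 0 "{}" x y] 0(5) matching_empty by auto
  qed
  then show ?case by simp
next
  case (Suc k)
  have finR: "finite R" using Suc.prems(1,2) finite_subset by blast
  show ?case
  proof (cases "\<exists>x\<in>Domain R. \<forall>M\<subseteq>R. matching M \<and> x \<notin> Domain M \<longrightarrow> card M \<le> 2 * k")
    case False
    have "\<exists>M\<subseteq>R. matching M \<and> card M = 2 * Suc k \<and> x \<notin> Domain M"
      if xR: "x \<in> Domain R" for x
    proof -
      obtain M where M: "M \<subseteq> R" "matching M" "x \<notin> Domain M" "\<not> card M \<le> 2 * k"
        using False xR by meson
      moreover have "even (card M)" "card M \<le> 2 * Suc k"
        using card_matching(2)[OF finite_subset[OF M(1) finR] M(2)] Suc.prems(5) M by auto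
      ultimately have "card M = 2 * Suc k" by presburger
      then show ?thesis using M by blast
    qed
    then have "card R \<le> 2 * Suc k * (2 * Suc k + 1)"
      using Suc.prems finR by (intro card_graph_all_vertices_avoidable) auto
    then have "int (card R) \<le> int (2 * Suc k * (2 * Suc k + 1))"
      by (rule of_nat_mono)
    then show ?thesis by (simp add: algebra_simps)
  next
    case True
    then obtain x where xR: "x \<in> Domain R"
      and x: "\<And>M. M \<subseteq> R \<Longrightarrow> matching M \<Longrightarrow> x \<notin> Domain M \<Longrightarrow> card M \<le> 2 * k"
      by blast
    have xV: "x \<in> V" using xR Suc.prems(2) by auto
    define s where "s = int (card V)"
    have V': "int (card (V - {x})) = s - 1"
      using card_Suc_Diff1[OF Suc.prems(1) xV] by (simp add: s_def)
    define R' where "R' = {(a, b) \<in> R. a \<noteq> x \<and> b \<noteq> x}"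
    have "int (card R') \<le> max (2 * int k * (2 * int k + 1))
        (int k * (int k - 1) + 2 * int k * (int (card (V - {x})) - int k))"
    proof (rule Suc.IH)
      show "card M \<le> 2 * k" if "M \<subseteq> R'" "matching M" for M
        using that by (intro x) (auto simp: R'_def)
    qed (use Suc.prems in \<open>auto simp: R'_def sym_def irrefl_def\<close>)
    then have IH: "int (card R') \<le> max (2 * int k * (2 * int k + 1))
        (int k * (int k - 1) + 2 * int k * (s - 1 - int k))"
      by (simp only: V')
    have "R \<subseteq> R' \<union> ({x} \<times> (V - {x}) \<union> (V - {x}) \<times> {x})"
      using Suc.prems(2,4) by (auto simp: R'_def irrefl_def)
    moreover have "finite R'" using finR by (rule rev_finite_subset) (auto simp: R'_def)
    ultimately have "card R \<le> card (R' \<union> ({x} \<times> (V - {x}) \<union> (V - {x}) \<times> {x}))"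
      using Suc.prems(1) by (intro card_mono) auto
    also have "\<dots> \<le> card R' + (card ({x} \<times> (V - {x})) + card ((V - {x}) \<times> {x}))"
      by (intro order_trans[OF card_Un_le] add_left_mono card_Un_le)
    also have "\<dots> = card R' + 2 * card (V - {x})"
      by (simp add: card_cartesian_product)
    finally have "int (card R) \<le> int (card R' + 2 * card (V - {x}))"
      by (rule of_nat_mono)
    then have step: "int (card R) \<le> int (card R') + 2 * (s - 1)"
      by (simp only: of_nat_add of_nat_mult V' of_nat_numeral)
    \<comment> \<open>Adding 2(s - 1) turns the second term for k exactly into that for k + 1. The
      clique term grows by 8k + 6, which suffices iff s is at most 4k + 4; beyond that the second
      term is already the larger one for k.\<close>
    show ?thesis
    proof (cases "s \<le> 4 * int k + 4")
      case True
      have "int (card R) \<le> max (2 * int k * (2 * int k + 1) + 2 * (s - 1))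
          (int k * (int k - 1) + 2 * int k * (s - 1 - int k) + 2 * (s - 1))"
        using IH step by linarith
      then show ?thesis
        using True by (auto simp: s_def[symmetric] max_def algebra_simps split: if_splits)
    next
      case False
      have "0 \<le> int k * (2 * (s - 1) - 5 * int k - 3)"
        using False by (intro mult_nonneg_nonneg) auto
      then have "int (card R') \<le> int k * (int k - 1) + 2 * int k * (s - 1 - int k)"
        using IH by (auto simp: max_def algebra_simps split: if_splits)
      then show ?thesis
        using step by (simp add: s_def[symmetric] algebra_simps)
    qed
  qed
qed

section \<open>Cover-free families\<close>

definition cover_free :: "nat \<Rightarrow> 'i set \<Rightarrow> ('i \<Rightarrow> 'a set) \<Rightarrow> bool" where
  "cover_free d I F \<longleftrightarrow> (\<forall>J\<subseteq>I. card J \<le> d \<longrightarrow> (\<forall>c\<in>I - J. \<not> F c \<subseteq> (\<Union>j\<in>J. F j)))"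

definition has_private :: "'i set \<Rightarrow> ('i \<Rightarrow> 'a set) \<Rightarrow> 'i \<Rightarrow> bool" where
  "has_private I F i \<longleftrightarrow> (\<exists>x\<in>F i. \<forall>j\<in>I - {i}. x \<notin> F j)"

text \<open>With \<open>own_pairs\<close>, this splits the complete graph on \<open>F i\<close> into
  two complementary graphs. Own pairs of different indices are disjoint, which allows double
  counting.\<close>

definition shared_pairs :: "'i set \<Rightarrow> ('i \<Rightarrow> 'a set) \<Rightarrow> 'i \<Rightarrow> ('a \<times> 'a) set" where
  "shared_pairs I F i = {(x, y) \<in> F i \<times> F i. x \<noteq> y \<and> (\<exists>j\<in>I - {i}. x \<in> F j \<and> y \<in> F j)}"

definition own_pairs :: "'i set \<Rightarrow> ('i \<Rightarrow> 'a set) \<Rightarrow> 'i \<Rightarrow> ('a \<times> 'a) set" where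
  "own_pairs I F i = {(x, y) \<in> F i \<times> F i. x \<noteq> y \<and> (\<forall>j\<in>I - {i}. \<not> (x \<in> F j \<and> y \<in> F j))}"

section \<open>Counting shared and own pairs\<close>

lemma card_off_diagonal:
  assumes "finite S"
  shows "card {(x, y) \<in> S \<times> S. x \<noteq> y} = card S * (card S - 1)"
proof -
  have "{(x, y) \<in> S \<times> S. x \<noteq> y} = (SIGMA x:S. S - {x})" by auto
  then have "card {(x, y) \<in> S \<times> S. x \<noteq> y} = (\<Sum>x\<in>S. card (S - {x}))"
    using assms by simp
  also have "\<dots> = (\<Sum>x\<in>S. card S - 1)"
    using assms by (intro sum.cong) auto
  finally show ?thesis by simp
qed

text \<open>One set covers both ends of a matching edge, and each unmatched point takes one more
  set. Everything is doubled because \<open>card M\<close> counts edges twice.\<close>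

lemma matching_yields_cover:
  assumes "finite M" "matching M" "finite S" "M \<subseteq> S \<times> S"
    and "\<forall>x\<in>S. \<exists>j\<in>K. x \<in> F j"
    and "\<forall>(x, y)\<in>M. \<exists>j\<in>K. x \<in> F j \<and> y \<in> F j"
  shows "\<exists>J\<subseteq>K. finite J \<and> 2 * card J + card M \<le> 2 * card S \<and> S \<subseteq> (\<Union>j\<in>J. F j)"
  using assms
proof (induction arbitrary: S rule: matching_induct)
  case empty
  obtain g where g: "\<forall>x\<in>S. g x \<in> K \<and> x \<in> F (g x)"
    using empty.prems(3) by metis
  have "card (g ` S) \<le> card S"
    using empty.prems(1) by (rule card_image_le)
  then show ?case
    using g empty.prems(1) by (intro exI[of _ "g ` S"]) auto
next
  case (insert x y M)
  have xyS: "x \<in> S" "y \<in> S" using insert.prems(2) by auto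
  obtain j where j: "j \<in> K" "x \<in> F j" "y \<in> F j" using insert.prems(4) by auto
  have "M \<subseteq> (S - {x, y}) \<times> (S - {x, y})"
    using insert.prems(2) insert.hyps(4,5) matching_symD[OF insert.hyps(2)] by blast
  then obtain J where J: "J \<subseteq> K" "finite J" "2 * card J + card M \<le> 2 * card (S - {x, y})"
    "S - {x, y} \<subseteq> (\<Union>j\<in>J. F j)"
    using insert.IH[of "S - {x, y}"] insert.prems by auto
  have "card S = card (S - {x, y}) + 2"
    using xyS insert.hyps(3) insert.prems(1) card_Diff_subset[of "{x, y}" S]
      card_mono[of S "{x, y}"] by simp
  moreover have "card (insert j J) \<le> card J + 1"
    using card_insert_le_m1[of "card J + 1" J j] by simp
  ultimately have "2 * card (insert j J) + card (insert (x, y) (insert (y, x) M)) \<le> 2 * card S"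
    using J(3) card_matching_insert[OF insert.hyps(1,3-5)] by linarith
  moreover have "S \<subseteq> (\<Union>j\<in>insert j J. F j)" using J(4) j by auto
  ultimately show ?case
    using J(1,2) j(1) by (intro exI[of _ "insert j J"]) auto
qed

text \<open>Without a private point, the other members cover \<open>F i\<close>, and a large
  matching makes this cheap; but at least d + 1 of them are required.\<close>

lemma cover_free_matching_bound:
  assumes "cover_free d I F" "i \<in> I" "finite (F i)" "\<not> has_private I F i"
    and M: "M \<subseteq> shared_pairs I F i" "matching M"
  shows "card M + 2 * (d + 1) \<le> 2 * card (F i)"
proof -
  have sub: "M \<subseteq> F i \<times> F i" using M(1) by (auto simp: shared_pairs_def)
  then have "finite M" using assms(3) finite_subset by blast
  then obtain J where J: "J \<subseteq> I - {i}" "2 * card J + card M \<le> 2 * card (F i)"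
    "F i \<subseteq> (\<Union>j\<in>J. F j)"
    using matching_yields_cover[of M "F i" "I - {i}" F] assms sub
    by (auto simp: has_private_def shared_pairs_def)
  have "\<not> card J \<le> d"
    using assms(1,2) J(1,3) unfolding cover_free_def by blast
  then show ?thesis using J(2) by simp
qed

text \<open>Erdos-Gallai with k = s - d - 1 bounds the shared pairs; the rest of the s(s - 1) pairs
  are own. The second extremal term leaves (s - k)(s - k - 1) = d(d + 1), the clique term leaves the
  quadratic.\<close>

lemma card_own_pairs_ge:
  assumes "cover_free d I F" "i \<in> I" "finite (F i)" "\<not> has_private I F i"
  defines "s \<equiv> int (card (F i))"
  shows "int d + 1 \<le> s"
    and "min (int d * (int d + 1)) (s * (s - 1) - (2 * s - 2 * int d - 2) * (2 * s - 2 * int d - 1))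
      \<le> int (card (own_pairs I F i))"
proof -
  note bound = cover_free_matching_bound[OF assms(1-4)]
  show s: "int d + 1 \<le> s"
    using bound[OF empty_subsetI matching_empty] by (simp add: s_def)
  define k where "k = card (F i) - d - 1"
  have k: "int k = s - int d - 1" using s by (simp add: k_def s_def)
  let ?O = "own_pairs I F i" and ?R = "shared_pairs I F i"
  have "int (card ?R) \<le> max (2 * int k * (2 * int k + 1))
    (int k * (int k - 1) + 2 * int k * (int (card (F i)) - int k))"
  proof (rule erdos_gallai_matching[OF assms(3)])
    show "card M \<le> 2 * k" if "M \<subseteq> ?R" "matching M" for M
      using bound[OF that] by (simp add: k_def)
  qed (auto simp: shared_pairs_def sym_def irrefl_def)
  then have R: "int (card ?R) \<le> max ((2 * s - 2 * int d - 2) * (2 * s - 2 * int d - 1))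
      (s * (s - 1) - int d * (int d + 1))"
    unfolding k s_def[symmetric] by (simp add: algebra_simps)
  have "?O \<union> ?R = {(x, y) \<in> F i \<times> F i. x \<noteq> y}" "?O \<inter> ?R = {}"
    by (auto simp: own_pairs_def shared_pairs_def)
  moreover have "finite ?O" "finite ?R"
    using assms(3) by (auto simp: own_pairs_def shared_pairs_def
      intro: rev_finite_subset[of "F i \<times> F i"])
  ultimately have "card ?O + card ?R = card (F i) * (card (F i) - 1)"
    using card_off_diagonal[OF assms(3)] card_Un_disjoint[of ?O ?R] by simp
  then have "int (card ?O + card ?R) = int (card (F i)) * int (card (F i) - 1)"
    by (simp only: of_nat_mult)
  moreover have "int (card (F i) - 1) = s - 1" using s by (simp add: s_def of_nat_diff)
  ultimately have "int (card ?O) + int (card ?R) = s * (s - 1)"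
    by (simp add: s_def)
  then show "min (int d * (int d + 1))
      (s * (s - 1) - (2 * s - 2 * int d - 2) * (2 * s - 2 * int d - 1)) \<le> int (card ?O)"
    using R by linarith
qed

section \<open>The constant\<close>

definition disjunct_const :: real where
  "disjunct_const = (15 + sqrt 33) / 24"

text \<open>At s = 2cd the quadratic of \<open>card_own_pairs_ge\<close> has leading coefficient 16c
  - 4 - 12c^2 in d; equating it to c gives this equation, of which the constant is the larger
  root.\<close>

lemma disjunct_const_root: "12 * disjunct_const\<^sup>2 = 15 * disjunct_const - 4"
proof -
  have "(sqrt 33)\<^sup>2 = 33" by simp
  then show ?thesis
    unfolding disjunct_const_def by (simp add: power2_eq_square field_simps)
qed

lemma disjunct_const_bounds: "43 / 50 < disjunct_const" "disjunct_const < 7 / 8"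
proof -
  have "574 / 100 < sqrt 33"
    by (rule real_less_rsqrt) (simp add: power2_eq_square)
  moreover have "sqrt 33 < 6"
    by (rule real_less_lsqrt) (simp_all add: power2_eq_square)
  ultimately show "43 / 50 < disjunct_const" "disjunct_const < 7 / 8"
    unfolding disjunct_const_def by simp_all
qed

text \<open>The right-hand side is concave in \<open>s\<close>, so only the endpoints matter; the constant is
  chosen to make the leading coefficients agree at \<open>s = c (2 d - 1)\<close>.\<close>

lemma own_pairs_quadratic_ge:
  fixes d s :: real
  assumes "2 \<le> d" "d + 1 \<le> s" "s \<le> disjunct_const * (2 * d - 1)"
  shows "disjunct_const * d\<^sup>2 \<le> s * (s - 1) - (2 * s - 2 * d - 2) * (2 * s - 2 * d - 1)"
proof -
  let ?c = disjunct_const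
  define f where "f = (\<lambda>s. s * (s - 1) - (2 * s - 2 * d - 2) * (2 * s - 2 * d - 1) - ?c * d\<^sup>2)"
  define a b where "a = d + 1" and "b = ?c * (2 * d - 1)"
  note c = disjunct_const_bounds disjunct_const_root
  have c2: "?c\<^sup>2 = (15 * ?c - 4) / 12" using c(3) by (simp add: field_simps)
  have ab: "a \<le> s" "s \<le> b" using assms by (auto simp: a_def b_def)
  have "?c * d\<^sup>2 \<le> 1 * d\<^sup>2" using c by (intro mult_right_mono) auto
  moreover have "f a = d\<^sup>2 + d - ?c * d\<^sup>2"
    by (simp add: f_def a_def algebra_simps power2_eq_square)
  ultimately have fa: "0 \<le> f a" using assms(1) by linarith
  have "f b = (16 * ?c - 4 - 12 * ?c\<^sup>2 - ?c) * d\<^sup>2 + (12 * ?c\<^sup>2 + 2 * ?c - 6) * d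
      - 3 * ?c\<^sup>2 - 5 * ?c - 2"
    by (simp add: f_def b_def algebra_simps power2_eq_square)
  \<comment> \<open>The root equation cancels the \<open>d\<close> squared term. What remains
    increases with \<open>d\<close> and is positive from d = 2 on.\<close>
  also have "\<dots> = (17 * ?c - 10) * d - (35 / 4 * ?c + 1)"
    unfolding c2 by (simp add: field_simps)
  also have "\<dots> \<ge> (17 * ?c - 10) * 2 - (35 / 4 * ?c + 1)"
    using c assms(1) by (intro diff_right_mono mult_left_mono) auto
  finally have fb: "0 \<le> f b" using c(1) by (simp add: field_simps)
  \<comment> \<open>Interpolation between the endpoints: the leading coefficient of \<open>f\<close>
    is -3, so \<open>f\<close> exceeds its chord by 3(s - a)(b - s).\<close>
  have "(b - a) * f s = 3 * (b - a) * (s - a) * (b - s) + (b - s) * f a + (s - a) * f b"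
    by (simp add: f_def algebra_simps power2_eq_square)
  also have "\<dots> \<ge> 0" using ab fa fb by (intro add_nonneg_nonneg mult_nonneg_nonneg) auto
  finally have "0 \<le> (b - a) * f s" .
  moreover have "f s = f a" if "b = a" using ab that by simp
  ultimately have "0 \<le> f s"
    using ab fa by (cases "b = a") (auto simp: zero_le_mult_iff)
  then show ?thesis by (simp add: f_def)
qed

section \<open>Small cover-free families have private points\<close>

lemma cover_free_remove:
  assumes "cover_free (Suc d) I F" "i \<in> I"
  shows "cover_free d (I - {i}) (\<lambda>j. F j - F i)"
  unfolding cover_free_def
proof (intro allI impI ballI notI)
  fix J c assume J: "J \<subseteq> I - {i}" "card J \<le> d" and c: "c \<in> I - {i} - J"
    and cov: "F c - F i \<subseteq> (\<Union>j\<in>J. F j - F i)"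
  have "card (insert i J) \<le> Suc d"
    using J(2) card_insert_le_m1[of "Suc d" J i] by simp
  moreover have "insert i J \<subseteq> I" "c \<in> I - insert i J" using J(1) c assms(2) by auto
  moreover have "F c \<subseteq> (\<Union>j\<in>insert i J. F j)" using cov by auto
  ultimately show False using assms(1) unfolding cover_free_def by blast
qed

lemma private_points_inj:
  assumes "\<And>i. i \<in> P \<Longrightarrow> p i \<in> F i" "\<And>i j. i \<in> P \<Longrightarrow> j \<in> I - {i} \<Longrightarrow> p i \<notin> F j" "P \<subseteq> I"
  shows "inj_on p P"
proof (rule inj_onI)
  fix i j assume "i \<in> P" "j \<in> P" "p i = p j"
  then show "i = j" using assms(1)[of j] assms(2)[of i j] assms(3) by auto
qed

text \<open>The slack of one admits n rows against n - 1 columns. It survives the induction, since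
  removing a member costs one index but at least three points.\<close>

lemma small_cover_free_has_private:
  assumes "cover_free d I F" "finite I" "finite X" "\<And>i. i \<in> I \<Longrightarrow> F i \<subseteq> X"
    and "card X \<le> card I + 1" "real (card X) < disjunct_const * (real d)\<^sup>2"
  shows "\<forall>i\<in>I. has_private I F i"
  using assms
proof (induction d arbitrary: I F X)
  case 0
  then show ?case by simp
next
  case (Suc d)
  let ?c = disjunct_const
  note c = disjunct_const_bounds
  define P Q where "P = {i \<in> I. has_private I F i}" and "Q = I - P"
  have "\<forall>i\<in>P. \<exists>x. x \<in> F i \<and> (\<forall>j\<in>I - {i}. x \<notin> F j)"
    unfolding P_def has_private_def by blast
  then obtain p where "\<forall>i\<in>P. p i \<in> F i \<and> (\<forall>j\<in>I - {i}. p i \<notin> F j)"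
    by metis
  then have p: "\<And>i. i \<in> P \<Longrightarrow> p i \<in> F i" "\<And>i j. i \<in> P \<Longrightarrow> j \<in> I - {i} \<Longrightarrow> p i \<notin> F j"
    by auto
  have PI: "P \<subseteq> I" "finite P" "finite Q"
    using Suc.prems(2) by (auto simp: P_def Q_def)
  have inj: "inj_on p P" using private_points_inj[of P p F I] p PI by blast
  \<comment> \<open>Members without a private point avoid all chosen private points, so they live in
    \<open>X'\<close>, and there are at least |X'| - 1 of them.\<close>
  define X' where "X' = X - p ` P"
  have pX: "p ` P \<subseteq> X" using p(1) Suc.prems(4) PI by blast
  have cX': "card X' + card P = card X"
    using card_Diff_subset[of "p ` P" X] card_mono[OF Suc.prems(3) pX] card_image[OF inj] pX PI
    by (simp add: X'_def)
  have cQ: "card Q + card P = card I"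
    using card_Diff_subset[of P I] card_mono[of I P] PI Suc.prems(2) by (simp add: Q_def)
  have finX': "finite X'" using Suc.prems(3) by (simp add: X'_def)
  have FX': "F i \<subseteq> X'" if "i \<in> Q" for i
    using that p(2) Suc.prems(4) by (auto simp: X'_def Q_def)
  have noP: "\<not> has_private I F i" if "i \<in> Q" for i
    using that by (auto simp: P_def Q_def)
  have finF: "finite (F i)" if "i \<in> I" for i
    using Suc.prems(3,4) that finite_subset by blast
  have "Q = {}"
  proof (rule ccontr)
    assume "Q \<noteq> {}"
    have big: "real (Suc d) + 1 \<le> real (card (F i))" if "i \<in> Q" for i
      using card_own_pairs_ge(1)[OF Suc.prems(1) _ finF noP] that by (force simp: Q_def)
    obtain i0 where i0: "i0 \<in> Q" using \<open>Q \<noteq> {}\<close> by auto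
    have le: "card (F i) \<le> card X'" if "i \<in> Q" for i
      using card_mono[OF finX' FX'[OF that]] .
    \<comment> \<open>This provides \<open>Suc d\<close> at least 2, as the quadratic estimate
      requires, and members with at least three points.\<close>
    have d: "1 \<le> d"
    proof (rule ccontr)
      assume "\<not> 1 \<le> d"
      then have "d = 0" by simp
      then have "real (card X) < 1" using Suc.prems(6) c by simp
      then show False using big[OF i0] le[OF i0] cX' by linarith
    qed
    show False
    proof (cases "\<exists>i\<in>Q. ?c * (2 * real (Suc d) - 1) \<le> real (card (F i))")
      case True
      then obtain i where i: "i \<in> Q" "?c * (2 * real (Suc d) - 1) \<le> real (card (F i))" by blast
      have iI: "i \<in> I" using i by (auto simp: Q_def)
      let ?F = "\<lambda>j. F j - F i" and ?I = "I - {i}" and ?X = "X - F i"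
      have cX: "card ?X + card (F i) = card X"
        using card_Diff_subset[of "F i" X] card_mono[of X "F i"] finF[OF iI] Suc.prems(3,4) iI by simp
      have cI: "card ?I + 1 = card I"
        using card_Suc_Diff1[OF Suc.prems(2) iI] by simp
      have F3: "3 \<le> card (F i)" using big[OF i(1)] d by linarith
      \<comment> \<open>The size threshold is exactly the difference of the bounds for
        \<open>Suc d\<close> and \<open>d\<close>.\<close>
      have "?c * (real (Suc d))\<^sup>2 - ?c * (2 * real (Suc d) - 1) = ?c * (real d)\<^sup>2"
        by (simp add: algebra_simps power2_eq_square)
      then have small: "real (card ?X) < ?c * (real d)\<^sup>2"
        using cX i(2) Suc.prems(6) by linarith
      have "\<forall>j\<in>?I. has_private ?I ?F j"
      proof (rule Suc.IH[where X = ?X])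
        show "cover_free d ?I ?F" by (rule cover_free_remove[OF Suc.prems(1) iI])
        show "card ?X \<le> card ?I + 1" using cX cI F3 Suc.prems(5) by linarith
      qed (use Suc.prems small in auto)
      then obtain r where r: "\<forall>j\<in>?I. r j \<in> ?F j \<and> (\<forall>k\<in>?I - {j}. r j \<notin> ?F k)"
        unfolding has_private_def by metis
      \<comment> \<open>Distinct private points give at least as many points as indices in the
        remainder, but removing three or more points left fewer.\<close>
      have "inj_on r ?I"
        by (rule private_points_inj[where F = ?F and I = ?I]) (use r in auto)
      moreover have "r ` ?I \<subseteq> ?X" using r Suc.prems(4) by blast
      ultimately have "card ?I \<le> card ?X"
        using card_inj_on_le[of r ?I ?X] Suc.prems(3) by simp
      then show False using cX cI F3 Suc.prems(5) by linarith
    next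
      case False
      have own: "?c * (real (Suc d))\<^sup>2 \<le> real (card (own_pairs I F i))" if i: "i \<in> Q" for i
      proof -
        define s where "s = int (card (F i))"
        let ?d = "int (Suc d)"
        let ?q = "s * (s - 1) - (2 * s - 2 * ?d - 2) * (2 * s - 2 * ?d - 1)"
        have "min (?d * (?d + 1)) ?q \<le> int (card (own_pairs I F i))"
          using card_own_pairs_ge(2)[OF Suc.prems(1) _ finF noP] i unfolding s_def Q_def by blast
        then have "real_of_int (min (?d * (?d + 1)) ?q) \<le> real (card (own_pairs I F i))"
          by linarith
        moreover have "?c * (real (Suc d))\<^sup>2 \<le> real_of_int (?d * (?d + 1))"
        proof -
          have "?c * (real (Suc d))\<^sup>2 \<le> 1 * (real (Suc d))\<^sup>2"
            using c by (intro mult_right_mono) auto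
          then show ?thesis by (simp add: algebra_simps power2_eq_square)
        qed
        moreover have "?c * (real (Suc d))\<^sup>2 \<le> real_of_int ?q"
        proof -
          have "real (Suc d) + 1 \<le> real_of_int s" using big[OF i] by (simp add: s_def)
          moreover have "real_of_int s \<le> ?c * (2 * real (Suc d) - 1)"
            using False i by (auto simp: s_def not_le intro: less_imp_le)
          ultimately show ?thesis
            using own_pairs_quadratic_ge[of "real (Suc d)" "real_of_int s"] d by simp
        qed
        ultimately show ?thesis by (simp add: min_def split: if_splits)
      qed
      have "(\<Sum>i\<in>Q. card (own_pairs I F i)) = card (\<Union>i\<in>Q. own_pairs I F i)"
      proof (rule card_UN_disjoint[symmetric])
        show "\<forall>i\<in>Q. finite (own_pairs I F i)"
          using finF by (auto simp: own_pairs_def Q_def intro: rev_finite_subset[of "F _ \<times> F _"])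
        show "\<forall>i\<in>Q. \<forall>j\<in>Q. i \<noteq> j \<longrightarrow> own_pairs I F i \<inter> own_pairs I F j = {}"
          by (auto simp: own_pairs_def Q_def)
      qed (rule PI)
      also have "\<dots> \<le> card {(x, y) \<in> X' \<times> X'. x \<noteq> y}"
        using finX' FX'
        by (intro card_mono) (auto simp: own_pairs_def intro: rev_finite_subset[of "X' \<times> X'"])
      finally have sum: "(\<Sum>i\<in>Q. card (own_pairs I F i)) \<le> card X' * (card X' - 1)"
        using card_off_diagonal[OF finX'] by simp
      have X'2: "2 \<le> card X'" using big[OF i0] le[OF i0] d by linarith
      \<comment> \<open>Double counting own pairs inside \<open>X'\<close>; the common factor |X'| -
        1 then cancels.\<close>
      have "real (card X' - 1) * (?c * (real (Suc d))\<^sup>2) \<le> real (card Q) * (?c * (real (Suc d))\<^sup>2)"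
        using cQ cX' Suc.prems(5) c by (intro mult_right_mono) auto
      also have "\<dots> = (\<Sum>i\<in>Q. ?c * (real (Suc d))\<^sup>2)" by simp
      also have "\<dots> \<le> (\<Sum>i\<in>Q. real (card (own_pairs I F i)))" by (intro sum_mono own)
      also have "\<dots> \<le> real (card X' * (card X' - 1))" using sum unfolding of_nat_sum[symmetric] of_nat_le_iff .
      also have "\<dots> = real (card X' - 1) * real (card X')" by simp
      finally have "?c * (real (Suc d))\<^sup>2 \<le> real (card X')"
        using X'2 by (subst (asm) mult_le_cancel_left_pos) auto
      then show False using Suc.prems(6) cX' by linarith
    qed
  qed
  then show ?case by (auto simp: Q_def P_def)
qed

section \<open>Disjunct matrices\<close>

text \<open>Binary entries turn inclusion of supports into the componentwise order.\<close>

lemma disjunct_mat_cover_free: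
  assumes "disjunct_mat t M"
  shows "cover_free t {..<dim_col M} (\<lambda>j. {i. i < dim_row M \<and> M $$ (i, j) = 1})"
  unfolding cover_free_def
proof (intro allI impI ballI notI)
  fix J c assume J: "J \<subseteq> {..<dim_col M}" "card J \<le> t" and c: "c \<in> {..<dim_col M} - J"
    and cov: "{i. i < dim_row M \<and> M $$ (i, c) = 1}
      \<subseteq> (\<Union>j\<in>J. {i. i < dim_row M \<and> M $$ (i, j) = 1})"
  have "M $$ (i, c) \<in> {0, 1}" if "i < dim_row M" for i
    using assms that c elements_matI[of M "dim_row M" "dim_col M" i c]
    unfolding disjunct_mat_def binary_mat_def by auto
  then have "col M c \<le> bool_sum_cols M J"
    using c cov unfolding less_eq_vec_def bool_sum_cols_def by fastforce
  then show False
    using assms J c unfolding disjunct_mat_def by blast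
qed

lemma permutation_mat_identity:
  assumes P: "P \<in> carrier_mat k k"
    and entry: "\<And>i j. i < k \<Longrightarrow> j < k \<Longrightarrow> P $$ (i, j) = (if i = j then 1 else 0)"
  shows "permutation_mat k P"
proof -
  have one: "P $$ (i, j) = 1 \<longleftrightarrow> i = j" if "i < k" "j < k" for i j
    using entry[OF that] by simp
  have "binary_mat P"
    unfolding binary_mat_def
  proof
    fix a assume "a \<in> elements_mat P"
    then obtain i j where "i < k" "j < k" "a = P $$ (i, j)" using P by (auto dest!: elements_matD)
    then show "a \<in> {0, 1}" using entry[of i j] by simp
  qed
  moreover have "\<exists>!j. j < k \<and> P $$ (i, j) = 1" if "i < k" for i
    using that one by (intro ex1I[of _ i]) blast+
  moreover have "\<exists>!i. i < k \<and> P $$ (i, j) = 1" if "j < k" for j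
    using that one by (intro ex1I[of _ j]) blast+
  ultimately show ?thesis using P by (simp add: permutation_mat_def)
qed

theorem theorem6p1:
  fixes t n :: nat and M :: "nat mat"
  assumes "0 < t"
    and "2 < n"
    and "real n < (15 + sqrt 33) / 24 * (real t)\<^sup>2"
    and "M \<in> carrier_mat n (n - 1)"
    and "disjunct_mat t M"
  shows "\<exists>\<sigma>. \<sigma> permutes {..<n} \<and> permutation_mat (n - 1) (first_rows (n - 1) (permute_rows \<sigma> M))"
proof -
  define F where "F = (\<lambda>j. {i. i < n \<and> M $$ (i, j) = 1})"
  have dim: "dim_row M = n" "dim_col M = n - 1" using assms(4) by auto
  have bin: "M $$ (i, j) \<in> {0, 1}" if "i < n" "j < n - 1" for i j
    using assms(5) elements_matI[OF assms(4) that]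
    unfolding disjunct_mat_def binary_mat_def by auto
  have "\<forall>j\<in>{..<n - 1}. has_private {..<n - 1} F j"
  proof (rule small_cover_free_has_private[where X = "{..<n}"])
    show "cover_free t {..<n - 1} F"
      using disjunct_mat_cover_free[OF assms(5)] unfolding dim F_def .
    show "real (card {..<n}) < disjunct_const * (real t)\<^sup>2"
      using assms(3) by (simp add: disjunct_const_def)
  qed (auto simp: F_def)
  then obtain r where r: "\<forall>j\<in>{..<n - 1}. r j \<in> F j \<and> (\<forall>k\<in>{..<n - 1} - {j}. r j \<notin> F k)"
    unfolding has_private_def by metis
  have inj: "inj_on r {..<n - 1}"
    by (rule private_points_inj[where F = F and I = "{..<n - 1}"]) (use r in auto)
  have sub: "r ` {..<n - 1} \<subseteq> {..<n}" using r by (auto simp: F_def)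
  have "card ({..<n} - r ` {..<n - 1}) = 1"
    using card_Diff_subset[OF _ sub] card_image[OF inj] assms(2) by simp
  then obtain z where z: "{..<n} - r ` {..<n - 1} = {z}" by (rule card_1_singletonE)
  \<comment> \<open>The private row of column i goes to position i, so the leading block is the
    identity. The single leftover row \<open>z\<close> goes last, and indices from n on stay
    fixed.\<close>
  define \<sigma> where "\<sigma> = (\<lambda>i. if i < n - 1 then r i else if i = n - 1 then z else i)"
  have split: "{..<n} = insert (n - 1) {..<n - 1}" using assms(2) by auto
  have "\<sigma> ` {..<n - 1} = r ` {..<n - 1}" "\<sigma> (n - 1) = z"
    by (auto simp: \<sigma>_def)
  then have "\<sigma> ` {..<n} = insert z (r ` {..<n - 1})"
    unfolding split by simp
  also have "\<dots> = {..<n}" using z sub by blast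
  finally have surj: "\<sigma> ` {..<n} = {..<n}" .
  then have "inj_on \<sigma> {..<n}" by (intro eq_card_imp_inj_on) simp_all
  then have "bij_betw \<sigma> {..<n} {..<n}" using surj by (simp add: bij_betw_def)
  then have "\<sigma> permutes {..<n}"
    by (rule bij_imp_permutes) (use assms(2) in \<open>auto simp: \<sigma>_def\<close>)
  moreover have "first_rows (n - 1) (permute_rows \<sigma> M) $$ (i, j) = (if i = j then 1 else 0)"
    if "i < n - 1" "j < n - 1" for i j
  proof -
    have "first_rows (n - 1) (permute_rows \<sigma> M) $$ (i, j) = M $$ (r i, j)"
      using that dim by (simp add: first_rows_def permute_rows_def \<sigma>_def)
    moreover have "M $$ (r i, j) \<in> {0, 1}" "M $$ (r i, j) = 1 \<longleftrightarrow> i = j"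
      using bin[of "r i" j] r that sub by (auto simp: F_def)
    ultimately show ?thesis by auto
  qed
  moreover have "first_rows (n - 1) (permute_rows \<sigma> M) \<in> carrier_mat (n - 1) (n - 1)"
    using dim by (auto simp: first_rows_def permute_rows_def)
  ultimately show ?thesis
    using permutation_mat_identity by blast
qed

end
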